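(* Let $G$ be a connected graph with $n$ vertices and $m$ edges, $p\ge1$, $\alpha\in(0,1)$, $\mu\in\mathbb{R}^{2p}$, $\Sigma\in\mathbb{R}^{2p\times2p}$ symmetric positive definite, and $\mathcal{T}_\alpha=\{\theta\in\mathbb{R}^{2p}:(\theta-\mu)^\top\Sigma^{-1}(\theta-\mu)\le\chi^2_{2p}(\alpha)\}$. Let $\varepsilon\in[0,1]$ and $\nu=1-(1-\varepsilon)^{2p}$. Consider the global depolarizing noise model in which the noisy depth-$p$ QAOA state is $$\rho^\varepsilon=(1-\nu)|\theta\rangle\langle\theta|+\nu\frac{I}{2^n},$$ and let $F_G^\varepsilon(\theta)=\mathrm{tr}(C\rho^\varepsilon)$, so that the noisy objective is $F_G^\varepsilon(\theta)=(1-\nu)F_G(\theta)+\nu\bar C$ with $\bar C=\mathrm{tr}(C)/2^n=m/2$. Let $\Theta_{\mathrm{TR}}$ be any random variable supported on $\mathcal{T}_\alpha$ almost surely and let $\Theta_{\mathrm{rand}}$ be a random variable in $\mathbb{R}^{2p}$ (a random initialization baseline). Assume $F_G(\mu)\ge r^*C_{\max}$ for some $r^*>0$. Then: (a) $$\mathbb{E}[F_G^\varepsilon(\Theta_{\mathrm{TR}})]\ge(1-\nu)\Bigl[r^*C_{\max}-L_G\sqrt{\chi^2_{2p}(\alpha)\|\Sigma\|_{\mathrm{op}}}\Bigr]+\nu\bar C.$$ (b) $$\mathbb{E}[F_G^\varepsilon(\Theta_{\mathrm{TR}})]-\mathbb{E}[F_G^\varepsilon(\Theta_{\mathrm{rand}})]=(1-\nu)\bigl(\mathbb{E}[F_G(\Theta_{\mathrm{TR}})]-\mathbb{E}[F_G(\Theta_{\mathrm{rand}})]\bigr).$$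 Hence, for $\varepsilon<1$, any noiseless expected advantage is preserved: if $\mathbb{E}[F_G(\Theta_{\mathrm{TR}})]>\mathbb{E}[F_G(\Theta_{\mathrm{rand}})]$ then $\mathbb{E}[F^\varepsilon_G(\Theta_{\mathrm{TR}})]>\mathbb{E}[F^\varepsilon_G(\Theta_{\mathrm{rand}})]$. (c) Whenever $\mathbb{E}[F_G^\varepsilon(\Theta_{\mathrm{rand}})]-\bar C\neq0$, $$\frac{\mathbb{E}[F_G^\varepsilon(\Theta_{\mathrm{TR}})]-\bar C}{\mathbb{E}[F_G^\varepsilon(\Theta_{\mathrm{rand}})]-\bar C}=\frac{\mathbb{E}[F_G(\Theta_{\mathrm{TR}})]-\bar C}{\mathbb{E}[F_G(\Theta_{\mathrm{rand}})]-\bar C}.$$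
   Context: $G=(V,E)$ is a finite simple unweighted graph with $|V|=n$, $|E|=m$. On $(\mathbb{C}^2)^{\otimes n}$ let $Z_i,X_i$ be Pauli operators on qubit $i$, $C=\sum_{(i,j)\in E}\frac12(I-Z_iZ_j)$, $B=\sum_iX_i$. For $\theta=(\gamma,\beta)\in\mathbb{R}^{2p}$, $|\theta\rangle=e^{-i\beta_pB}e^{-i\gamma_pC}\cdots e^{-i\beta_1B}e^{-i\gamma_1C}|+\rangle^{\otimes n}$ and $F_G(\theta)=\langle\theta|C|\theta\rangle$. $C_{\max}$ is the maximum cut value of $G$. $\chi^2_{2p}(\alpha)$ is the $\alpha$-quantile of the chi-square distribution with $2p$ degrees of freedom. $L_G:=\sup_{\theta\in\mathbb{R}^{2p}}\|\nabla F_G(\theta)\|_2$ is the global Lipschitz constant of $F_G$; $\|\cdot\|_{\mathrm{op}}$ is the operator norm. *)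

theory Defs
  imports "HOL-Probability.Probability"
begin

section \<open>Graphs\<close>

text \<open>
  A graph has the whole finite type \<open>'v\<close> as its vertex set and is given by its set \<open>E\<close> of
  unordered edges, so that \<open>n = CARD('v)\<close> and \<open>m = card E\<close>.
\<close>

definition simple_graph :: "'v::finite set set \<Rightarrow> bool" where
  "simple_graph E \<longleftrightarrow> (\<forall>e\<in>E. card e = 2)"

definition connected_graph :: "'v::finite set set \<Rightarrow> bool" where
  "connected_graph E \<longleftrightarrow> (\<forall>u v. (u, v) \<in> {(a, b). {a, b} \<in> E}\<^sup>*)"

definition cut_value :: "'v::finite set set \<Rightarrow> 'v set \<Rightarrow> nat" where
  "cut_value E S = card {e \<in> E. card (e \<inter> S) = 1}"

definition max_cut :: "'v::finite set set \<Rightarrow> nat" where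
  "max_cut E = Max (range (cut_value E))"


section \<open>Qubit states and operators\<close>

text \<open>
  The space of the qubits attached to the vertices has the computational basis indexed by bit
  strings \<open>'v \<Rightarrow> bool\<close>, where \<open>False\<close> labels the basis vector 0 and \<open>True\<close> the basis vector 1.
\<close>

type_synonym 'v state = "complex ^ ('v \<Rightarrow> bool)"
type_synonym 'v operator = "complex ^ ('v \<Rightarrow> bool) ^ ('v \<Rightarrow> bool)"

definition pauli_X :: "complex ^ bool ^ bool" where
  "pauli_X = (\<chi> a b. if a = b then 0 else 1)"

definition pauli_Z :: "complex ^ bool ^ bool" where
  "pauli_Z = (\<chi> a b. if a = b then (if a then -1 else 1) else 0)"

text \<open>The tensor product of \<open>A\<close> on qubit \<open>i\<close> with the identity on all other qubits.\<close>

definition on_qubit :: "'v::finite \<Rightarrow> complex ^ bool ^ bool \<Rightarrow> 'v operator" where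
  "on_qubit i A =
     (\<chi> x y. A $ x i $ y i * (\<Prod>j\<in>UNIV - {i}. (mat 1 :: complex ^ bool ^ bool) $ x j $ y j))"

definition cscale :: "complex \<Rightarrow> complex ^ 'n ^ 'm \<Rightarrow> complex ^ 'n ^ 'm" where
  "cscale c A = (\<chi> i j. c * A $ i $ j)"

text \<open>
  Multiplication in the ring structure on vectors is componentwise, so neither \<open>exp\<close> nor the power
  operation may be used for matrices.
\<close>

definition matrix_power :: "complex ^ 'n ^ 'n \<Rightarrow> nat \<Rightarrow> complex ^ 'n ^ 'n" where
  "matrix_power A k = (((**) A) ^^ k) (mat 1)"

definition matrix_exp :: "complex ^ 'n ^ 'n \<Rightarrow> complex ^ 'n ^ 'n" where
  "matrix_exp A = (\<Sum>k. (1 / fact k) *\<^sub>R matrix_power A k)"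

definition braket :: "complex ^ 'n \<Rightarrow> complex ^ 'n \<Rightarrow> complex" where
  "braket u v = (\<Sum>x\<in>UNIV. cnj (u $ x) * v $ x)"

definition ketbra :: "complex ^ 'n \<Rightarrow> complex ^ 'n \<Rightarrow> complex ^ 'n ^ 'n" where
  "ketbra u v = (\<chi> x y. u $ x * cnj (v $ y))"


section \<open>QAOA\<close>

text \<open>
  \<open>edge_ZZ {i, j}\<close> is the product of the Pauli Z operators on \<open>i\<close> and \<open>j\<close>; it does not depend on
  the order of the two endpoints since these operators commute (lemma \<open>edge_ZZ_pair\<close>).
\<close>

definition edge_ZZ :: "'v::finite set \<Rightarrow> 'v operator" where
  "edge_ZZ e =
     (THE A. \<exists>i j. i \<noteq> j \<and> e = {i, j} \<and> A = on_qubit i pauli_Z ** on_qubit j pauli_Z)"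

definition cost_op :: "'v::finite set set \<Rightarrow> 'v operator" where
  "cost_op E = (\<Sum>e\<in>E. (1 / 2) *\<^sub>R (mat 1 - edge_ZZ e))"

definition mixer_op :: "'v::finite operator" where
  "mixer_op = (\<Sum>i\<in>UNIV. on_qubit i pauli_X)"

definition plus_state :: "'v::finite state" where
  "plus_state = (\<chi> x. \<Prod>i\<in>(UNIV::'v set). 1 / complex_of_real (sqrt 2))"

text \<open>
  The layers are indexed by a finite linear order \<open>'p\<close>, so that the depth is \<open>p = CARD('p)\<close>; they are
  applied in increasing order. The parameter space is \<open>real ^ ('p + 'p)\<close>, of dimension \<open>2p\<close>, with
  \<open>\<theta> $ Inl k\<close> the angle \<open>\<gamma>\<^sub>k\<close> of the cost layer and \<open>\<theta> $ Inr k\<close> the angle \<open>\<beta>\<^sub>k\<close> of the mixer layer.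
\<close>

type_synonym 'p params = "real ^ ('p + 'p)"

definition qaoa_layer ::
  "'v::finite set set \<Rightarrow> 'p::finite params \<Rightarrow> 'p \<Rightarrow> 'v state \<Rightarrow> 'v state" where
  "qaoa_layer E \<theta> k \<psi> =
     matrix_exp (cscale (- \<i> * complex_of_real (\<theta> $ Inr k)) mixer_op) *v
     (matrix_exp (cscale (- \<i> * complex_of_real (\<theta> $ Inl k)) (cost_op E)) *v \<psi>)"

definition qaoa_state ::
  "'v::finite set set \<Rightarrow> 'p::{finite,linorder} params \<Rightarrow> 'v state" where
  "qaoa_state E \<theta> =
     fold (qaoa_layer E \<theta>) (sorted_list_of_set (UNIV :: 'p set)) plus_state"

text \<open>Taking the real part loses nothing here, see lemma \<open>braket_cost_op_real\<close>.\<close>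

definition qaoa_objective ::
  "'v::finite set set \<Rightarrow> 'p::{finite,linorder} params \<Rightarrow> real" where
  "qaoa_objective E \<theta> = Re (braket (qaoa_state E \<theta>) (cost_op E *v qaoa_state E \<theta>))"

definition gradient :: "('a::real_inner \<Rightarrow> real) \<Rightarrow> 'a \<Rightarrow> 'a" where
  "gradient f x = (THE D. GDERIV f x :> D)"

definition lipschitz_const ::
  "('p::{finite,linorder}) itself \<Rightarrow> 'v::finite set set \<Rightarrow> real" where
  "lipschitz_const _ E = (SUP \<theta> :: 'p params. norm (gradient (qaoa_objective E) \<theta>))"


section \<open>Global depolarizing noise\<close>

definition noise_strength :: "nat \<Rightarrow> real \<Rightarrow> real" where
  "noise_strength p \<epsilon> = 1 - (1 - \<epsilon>) ^ (2 * p)"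

definition noisy_state ::
  "'v::finite set set \<Rightarrow> real \<Rightarrow> 'p::{finite,linorder} params \<Rightarrow> 'v operator" where
  "noisy_state E \<epsilon> \<theta> =
     (let \<nu> = noise_strength CARD('p) \<epsilon>
      in (1 - \<nu>) *\<^sub>R ketbra (qaoa_state E \<theta>) (qaoa_state E \<theta>)
         + \<nu> *\<^sub>R ((1 / 2 ^ CARD('v)) *\<^sub>R mat 1))"

definition noisy_objective ::
  "'v::finite set set \<Rightarrow> real \<Rightarrow> 'p::{finite,linorder} params \<Rightarrow> real" where
  "noisy_objective E \<epsilon> \<theta> = Re (trace (cost_op E ** noisy_state E \<epsilon> \<theta>))"

definition mean_cost :: "'v::finite set set \<Rightarrow> real" where
  "mean_cost E = Re (trace (cost_op E) / 2 ^ CARD('v))"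


section \<open>Trust regions\<close>

definition chi_square :: "nat \<Rightarrow> real measure" where
  "chi_square d =
     distr (PiM {..<d} (\<lambda>_. std_normal_distribution)) borel (\<lambda>z. \<Sum>i<d. (z i)\<^sup>2)"

definition quantile :: "real measure \<Rightarrow> real \<Rightarrow> real" where
  "quantile M \<alpha> = Inf {x. \<alpha> \<le> cdf M x}"

definition sym_pos_def :: "real ^ 'n ^ 'n \<Rightarrow> bool" where
  "sym_pos_def S \<longleftrightarrow> transpose S = S \<and> (\<forall>x. x \<noteq> 0 \<longrightarrow> 0 < x \<bullet> (S *v x))"

definition trust_region ::
  "'p::finite params \<Rightarrow> real ^ ('p + 'p) ^ ('p + 'p) \<Rightarrow> real \<Rightarrow> 'p params set" where
  "trust_region \<mu> S \<alpha> =
     {\<theta>. (\<theta> - \<mu>) \<bullet> (matrix_inv S *v (\<theta> - \<mu>)) \<le> quantile (chi_square (2 * CARD('p))) \<alpha>}"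


section \<open>Well-definedness of the cost operator\<close>

lemma on_qubit_pauli_Z:
  "on_qubit i pauli_Z $ x $ y = (if x = y then (if x i then -1 else 1) else 0)"
proof (cases "x = y")
  case False
  then obtain j where "x j \<noteq> y j" by blast
  then show ?thesis
    using False by (cases "j = i") (auto simp: on_qubit_def pauli_Z_def mat_def intro!: prod_zero)
qed (simp add: on_qubit_def pauli_Z_def mat_def)

lemma pauli_Z_mult:
  "(on_qubit i pauli_Z ** on_qubit j pauli_Z) $ x $ y =
     (if x = y then (if x i = x j then 1 else -1) else 0)"
proof -
  have "(on_qubit i pauli_Z ** on_qubit j pauli_Z) $ x $ y =
      (\<Sum>z\<in>UNIV. on_qubit i pauli_Z $ x $ z * on_qubit j pauli_Z $ z $ y)"
    by (simp add: matrix_matrix_mult_def)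
  also have "\<dots> = (\<Sum>z\<in>UNIV. if z = x
      then (if x i then -1 else 1) * (if x = y then (if x j then -1 else 1) else 0) else 0)"
    by (intro sum.cong refl) (auto simp: on_qubit_pauli_Z)
  also have "\<dots> = (if x i then -1 else 1) * (if x = y then (if x j then -1 else 1) else 0)"
    by (subst sum.delta) simp_all
  finally show ?thesis by simp
qed

lemma pauli_Z_commute:
  "on_qubit i pauli_Z ** on_qubit j pauli_Z = on_qubit j pauli_Z ** on_qubit i pauli_Z"
  by (simp add: vec_eq_iff pauli_Z_mult eq_commute)

lemma edge_ZZ_pair:
  assumes "i \<noteq> j"
  shows "edge_ZZ {i, j} = on_qubit i pauli_Z ** on_qubit j pauli_Z"
  unfolding edge_ZZ_def
proof (rule the_equality)
  fix A assume "\<exists>k l. k \<noteq> l \<and> {i, j} = {k, l} \<and> A = on_qubit k pauli_Z ** on_qubit l pauli_Z"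
  then show "A = on_qubit i pauli_Z ** on_qubit j pauli_Z"
    by (metis doubleton_eq_iff pauli_Z_commute)
qed (use assms in blast)

lemma cost_op_diagonal:
  assumes "simple_graph E"
  shows "cost_op E $ x $ y = (if x = y then of_nat (cut_value E {v. x v}) else 0)"
proof -
  have edge: "((1 / 2) *\<^sub>R (mat 1 - edge_ZZ e)) $ x $ y =
      (if x = y \<and> card (e \<inter> {v. x v}) = 1 then 1 else 0)" if "e \<in> E" for e
  proof -
    from assms that obtain i j where ij: "i \<noteq> j" "e = {i, j}"
      unfolding simple_graph_def card_2_iff by blast
    have "e \<inter> {v. x v} = (if x i then {i} else {}) \<union> (if x j then {j} else {})"
      using ij by auto
    then have "card (e \<inter> {v. x v}) = 1 \<longleftrightarrow> x i \<noteq> x j"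
      using ij(1) by auto
    then show ?thesis
      by (simp add: ij edge_ZZ_pair pauli_Z_mult mat_def scaleR_conv_of_real[where 'a = complex])
  qed
  have "cost_op E $ x $ y = (\<Sum>e\<in>E. if x = y \<and> card (e \<inter> {v. x v}) = 1 then 1 else 0)"
    unfolding cost_op_def sum_component by (intro sum.cong refl edge)
  also have "\<dots> = (if x = y then of_nat (cut_value E {v. x v}) else 0)"
    by (simp add: cut_value_def sum.If_cases Int_def)
  finally show ?thesis .
qed

lemma braket_cost_op_real:
  assumes "simple_graph E"
  shows "braket \<psi> (cost_op E *v \<psi>) \<in> \<real>"
proof -
  have "(cost_op E *v \<psi>) $ x = of_nat (cut_value E {v. x v}) * \<psi> $ x" for x
    by (simp add: matrix_vector_mult_def cost_op_diagonal[OF assms] if_distrib[of "\<lambda>c. c * _"]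
        cong: if_cong)
  then have "braket \<psi> (cost_op E *v \<psi>) =
      (\<Sum>x\<in>UNIV. of_nat (cut_value E {v. x v}) * complex_of_real ((cmod (\<psi> $ x))\<^sup>2))"
    unfolding complex_norm_square by (simp add: braket_def mult_ac)
  also have "\<dots> \<in> \<real>"
    by (intro sum_in_Reals Reals_mult) auto
  finally show ?thesis .
qed

end

theory Submission
  imports Defs
begin

text \<open>
  The eigenvalues of the cost and mixer operators are real, so spectral decompositions express
  every amplitude of the QAOA state as a polynomial in the phases \<open>exp (- \<i> \<theta>\<^sub>k \<lambda>)\<close>. Hence the objective
  and its gradient are bounded, all expectations exist, and the objective is Lipschitz with
  constant \<open>L\<^sub>G\<close>. The Cauchy--Schwarz inequality for the form defined by \<open>S\<close> bounds the distance
  from \<open>\<mu>\<close> to a point of the trust region by the square root of the quantile times the operator norm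
  of \<open>S\<close>. The noise acts on the objective by an affine map, which gives all statements about noisy
  expectations.
\<close>

section \<open>Matrix exponentials from spectral decompositions\<close>

lemma matrix_power_0: "matrix_power A 0 = mat 1"
  by (simp add: matrix_power_def)

lemma matrix_power_Suc: "matrix_power A (Suc k) = A ** matrix_power A k"
  by (simp add: matrix_power_def)

lemma cscale_nth: "cscale c A $ i $ j = c * A $ i $ j"
  by (simp add: cscale_def)

text \<open>The completeness assumption resolves the identity into rank-one terms pairing
  \<open>u s\<close> with \<open>w s\<close>. Each multiplication by \<open>A\<close> acts only on
  \<open>u s\<close> and yields one more factor \<open>l s\<close>. Keeping \<open>w\<close> apart
  from \<open>u\<close> lets the normalisation of the eigenbasis sit in one factor.\<close>

lemma matrix_power_spectral:
  fixes A :: "complex ^ 'n ^ 'n"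
  assumes eig: "\<And>s x. (\<Sum>z\<in>UNIV. A $ x $ z * u s z) = l s * u s x"
    and compl: "\<And>x y. (\<Sum>s\<in>I. u s x * w s y) = (if x = y then 1 else 0)"
  shows "matrix_power (cscale c A) k $ x $ y = (\<Sum>s\<in>I. (c * l s) ^ k * (u s x * w s y))"
proof (induction k arbitrary: x)
  case 0
  show ?case by (simp add: matrix_power_0 compl mat_def)
next
  case (Suc k)
  have "matrix_power (cscale c A) (Suc k) $ x $ y =
      (\<Sum>z\<in>UNIV. \<Sum>s\<in>I. (c * l s) ^ k * c * w s y * (A $ x $ z * u s z))"
    by (simp add: matrix_power_Suc matrix_matrix_mult_def Suc.IH cscale_nth sum_distrib_left mult_ac)
  also have "\<dots> = (\<Sum>s\<in>I. (c * l s) ^ k * c * w s y * (\<Sum>z\<in>UNIV. A $ x $ z * u s z))"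
    by (subst sum.swap) (simp add: sum_distrib_left)
  finally show ?case
    unfolding eig by (simp add: mult_ac)
qed

lemma matrix_exp_spectral:
  fixes A :: "complex ^ 'n ^ 'n"
  assumes eig: "\<And>s x. (\<Sum>z\<in>UNIV. A $ x $ z * u s z) = l s * u s x"
    and compl: "\<And>x y. (\<Sum>s\<in>I. u s x * w s y) = (if x = y then 1 else 0)"
  shows "matrix_exp (cscale c A) $ x $ y = (\<Sum>s\<in>I. exp (c * l s) * (u s x * w s y))"
proof -
  let ?R = "(\<chi> x y. \<Sum>s\<in>I. exp (c * l s) * (u s x * w s y)) :: complex ^ 'n ^ 'n"
  \<comment> \<open>Convergence is checked entry by entry, where the matrix series is a sum over
    \<open>s\<close> of scalar exponential series.\<close>
  have "(\<lambda>k. ((1 / fact k) *\<^sub>R matrix_power (cscale c A) k) $ x $ y) sums (?R $ x $ y)" for x y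
  proof -
    have "(\<lambda>k. \<Sum>s\<in>I. ((c * l s) ^ k /\<^sub>R fact k) * (u s x * w s y)) sums
        (\<Sum>s\<in>I. exp (c * l s) * (u s x * w s y))"
      by (intro sums_sum sums_mult2 exp_converges)
    then show ?thesis
      by (simp add: matrix_power_spectral[OF eig compl] scaleR_right.sum divide_inverse)
  qed
  then have "(\<lambda>k. (1 / fact k) *\<^sub>R matrix_power (cscale c A) k) sums ?R"
    unfolding sums_def by (intro vec_tendstoI) simp
  then show ?thesis
    by (simp add: matrix_exp_def sums_iff)
qed

section \<open>Spectra of the cost and mixer operators\<close>

lemma matrix_exp_cost_op:
  assumes "simple_graph E"
  shows "matrix_exp (cscale c (cost_op E)) $ x $ y =
    (\<Sum>s\<in>UNIV. exp (c * of_nat (cut_value E {v. s v})) *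
       ((if s = x then 1 else 0) * (if s = y then 1 else 0)))"
\<comment> \<open>The cost operator is diagonal, so the computational basis serves as eigenbasis and
  as its own dual basis.\<close>
proof (rule matrix_exp_spectral)
  fix s x :: "'a \<Rightarrow> bool"
  show "(\<Sum>z\<in>UNIV. cost_op E $ x $ z * (if s = z then 1 else 0)) =
      of_nat (cut_value E {v. s v}) * (if s = x then 1 else 0)"
    by (simp add: cost_op_diagonal[OF assms] if_distrib[of "\<lambda>c. _ * c"] cong: if_cong)
next
  fix x y :: "'a \<Rightarrow> bool"
  show "(\<Sum>s\<in>UNIV. (if s = x then 1 else 0) * (if s = y then 1 else (0::complex))) =
      (if x = y then 1 else 0)"
    by (simp add: if_distrib[of "\<lambda>c. _ * c"] cong: if_cong)
qed

text \<open>Up to normalisation, \<open>walsh s\<close> is the product state with \<open>|->\<close>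
  on the qubits where \<open>s\<close> holds and \<open>|+>\<close> on the others: a common
  eigenvector of all Pauli X operators.\<close>

definition walsh :: "('v::finite \<Rightarrow> bool) \<Rightarrow> ('v \<Rightarrow> bool) \<Rightarrow> complex" where
  "walsh s x = (\<Prod>i\<in>UNIV. if s i \<and> x i then -1 else 1)"

definition mixer_eigenvalue :: "('v::finite \<Rightarrow> bool) \<Rightarrow> real" where
  "mixer_eigenvalue s = (\<Sum>i\<in>UNIV. if s i then -1 else 1)"

lemma walsh_flip: "walsh s (x(i := \<not> x i)) = (if s i then -1 else 1) * walsh s x"
proof -
  have "(\<Prod>j\<in>UNIV - {i}. if s j \<and> (x(i := \<not> x i)) j then -1 else (1::complex)) =
      (\<Prod>j\<in>UNIV - {i}. if s j \<and> x j then -1 else 1)"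
    by (intro prod.cong) auto
  then show ?thesis
    unfolding walsh_def by (simp add: prod.remove[of UNIV i])
qed

text \<open>The sum over all bit strings \<open>s\<close> factorises into a product over qubits of
  two-term sums. The factor at \<open>i\<close> is 1 + 1 if \<open>x\<close> and \<open>y\<close>
  agree there and 1 - 1 otherwise.\<close>

lemma walsh_complete:
  fixes x y :: "'v::finite \<Rightarrow> bool"
  shows "(\<Sum>s\<in>UNIV. walsh s x * (walsh s y / 2 ^ CARD('v))) = (if x = y then 1 else 0)"
proof -
  have "(\<Sum>s\<in>UNIV. walsh s x * walsh s y) =
      (\<Sum>s\<in>PiE UNIV (\<lambda>_. UNIV). \<Prod>i\<in>UNIV.
        (\<lambda>i b. (if b \<and> x i then -1 else 1) * (if b \<and> y i then -1 else (1::complex))) i (s i))"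
    by (simp add: walsh_def prod.distrib)
  also have "\<dots> = (\<Prod>i\<in>UNIV. \<Sum>b\<in>UNIV.
      (if b \<and> x i then -1 else 1) * (if b \<and> y i then -1 else (1::complex)))"
    by (rule prod_sum_PiE[symmetric]) auto
  also have "\<dots> = (\<Prod>i\<in>UNIV. if x i = y i then 2 else 0)"
    by (intro prod.cong) (auto simp: UNIV_bool)
  also have "\<dots> = (if x = y then 2 ^ CARD('v) else 0)"
    by (auto simp: fun_eq_iff intro!: prod_zero)
  finally show ?thesis
    by (simp flip: sum_divide_distrib)
qed

lemma on_qubit_pauli_X:
  "on_qubit i pauli_X $ x $ y = (if y = x(i := \<not> x i) then 1 else 0)"
proof -
  have "y = x(i := \<not> x i)" if "y i \<noteq> x i" "\<forall>j. j \<noteq> i \<longrightarrow> y j = x j"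
    by (rule ext) (use that in auto)
  then consider "y = x(i := \<not> x i)" | "y i = x i" | j where "j \<noteq> i" "y j \<noteq> x j"
    by blast
  then show ?thesis
  proof cases
    case 3
    then have "(\<Prod>j\<in>UNIV - {i}. (mat 1 :: complex ^ bool ^ bool) $ x j $ y j) = 0"
      by (intro prod_zero) (auto simp: mat_def)
    with 3 show ?thesis by (auto simp: on_qubit_def)
  qed (auto simp: on_qubit_def pauli_X_def mat_def)
qed

text \<open>The X operator on qubit \<open>i\<close> flips bit \<open>i\<close>, which by
  \<open>walsh_flip\<close> multiplies \<open>walsh s\<close> by a sign. The eigenvalue is the sum
  of these signs.\<close>

lemma mixer_op_walsh:
  "(\<Sum>z\<in>UNIV. mixer_op $ x $ z * walsh s z) = complex_of_real (mixer_eigenvalue s) * walsh s x"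
proof -
  have "(\<Sum>z\<in>UNIV. mixer_op $ x $ z * walsh s z) =
      (\<Sum>i\<in>UNIV. \<Sum>z\<in>UNIV. if z = x(i := \<not> x i) then walsh s z else 0)"
    by (subst sum.swap)
      (simp add: mixer_op_def sum_component on_qubit_pauli_X sum_distrib_right
        if_distrib[of "\<lambda>c. c * _"] cong: if_cong)
  also have "\<dots> = (\<Sum>i\<in>UNIV. (if s i then -1 else 1) * walsh s x)"
    by (simp add: walsh_flip)
  also have "\<dots> = complex_of_real (mixer_eigenvalue s) * walsh s x"
    by (simp add: mixer_eigenvalue_def sum_distrib_right if_distrib[of complex_of_real] cong: if_cong)
  finally show ?thesis .
qed

lemma matrix_exp_mixer_op:
  "matrix_exp (cscale c (mixer_op :: 'v::finite operator)) $ x $ y =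
    (\<Sum>s\<in>UNIV. exp (c * complex_of_real (mixer_eigenvalue s)) *
       (walsh s x * (walsh s y / 2 ^ CARD('v))))"
  by (intro matrix_exp_spectral mixer_op_walsh walsh_complete)


section \<open>Bounded functions with bounded derivative\<close>

text \<open>A class of functions containing constants and phases and closed under sums, products and
  bounded linear maps, so that membership of the objective can be read off its formula. Bounding the
  function as well as its derivative is what gives closure under products.\<close>

definition bounded_deriv :: "('a::real_normed_vector \<Rightarrow> 'b::real_normed_vector) \<Rightarrow> bool" where
  "bounded_deriv f \<longleftrightarrow> (\<exists>f' K. \<forall>x. norm (f x) \<le> K \<and> (f has_derivative f' x) (at x) \<and>
     (\<forall>v. norm (f' x v) \<le> K * norm v))"

lemma bounded_derivI:
  assumes "\<And>x. norm (f x) \<le> K" "\<And>x. (f has_derivative f' x) (at x)"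
    "\<And>x v. norm (f' x v) \<le> L * norm v"
  shows "bounded_deriv f"
proof -
  have "norm (f x) \<le> max K L" for x
    using assms(1)[of x] by linarith
  moreover have "norm (f' x v) \<le> max K L * norm v" for x v
    using assms(3)[of x v] mult_right_mono[of L "max K L" "norm v"] by fastforce
  ultimately show ?thesis
    unfolding bounded_deriv_def using assms(2) by blast
qed

lemma bounded_derivE:
  assumes "bounded_deriv f"
  obtains f' K where "0 \<le> K" "\<And>x. norm (f x) \<le> K" "\<And>x. (f has_derivative f' x) (at x)"
    "\<And>x v. norm (f' x v) \<le> K * norm v"
  using assms unfolding bounded_deriv_def by (meson norm_ge_zero order_trans)

lemma bounded_deriv_const: "bounded_deriv (\<lambda>x. c)"
  by (rule bounded_derivI[where f' = "\<lambda>x v. 0" and L = 0]) auto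

lemma bounded_deriv_add:
  assumes "bounded_deriv f" "bounded_deriv g"
  shows "bounded_deriv (\<lambda>x. f x + g x)"
proof -
  obtain f' K where f: "0 \<le> K" "\<And>x. norm (f x) \<le> K" "\<And>x. (f has_derivative f' x) (at x)"
    "\<And>x v. norm (f' x v) \<le> K * norm v"
    using assms(1) by (rule bounded_derivE) blast
  obtain g' L where g: "0 \<le> L" "\<And>x. norm (g x) \<le> L" "\<And>x. (g has_derivative g' x) (at x)"
    "\<And>x v. norm (g' x v) \<le> L * norm v"
    using assms(2) by (rule bounded_derivE) blast
  show ?thesis
  proof (rule bounded_derivI)
    show "norm (f x + g x) \<le> K + L" for x
      using f(2) g(2) by (rule norm_add_rule_thm)
    show "((\<lambda>x. f x + g x) has_derivative (\<lambda>v. f' x v + g' x v)) (at x)" for x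
      by (intro has_derivative_add f g)
    show "norm (f' x v + g' x v) \<le> (K + L) * norm v" for x v
      using norm_add_rule_thm[OF f(4) g(4)] by (simp add: distrib_right)
  qed
qed

lemma bounded_deriv_mult:
  fixes f g :: "'a::real_normed_vector \<Rightarrow> 'b::real_normed_algebra"
  assumes "bounded_deriv f" "bounded_deriv g"
  shows "bounded_deriv (\<lambda>x. f x * g x)"
proof -
  obtain f' K where f: "0 \<le> K" "\<And>x. norm (f x) \<le> K" "\<And>x. (f has_derivative f' x) (at x)"
    "\<And>x v. norm (f' x v) \<le> K * norm v"
    using assms(1) by (rule bounded_derivE) blast
  obtain g' L where g: "0 \<le> L" "\<And>x. norm (g x) \<le> L" "\<And>x. (g has_derivative g' x) (at x)"
    "\<And>x v. norm (g' x v) \<le> L * norm v"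
    using assms(2) by (rule bounded_derivE) blast
  have prod: "norm (a * b) \<le> p * q" if "norm a \<le> p" "norm b \<le> q" for a b :: 'b and p q
    using that by (meson mult_mono norm_ge_zero norm_mult_ineq order_trans)
  show ?thesis
  proof (rule bounded_derivI)
    show "norm (f x * g x) \<le> K * L" for x
      by (intro prod f g)
    show "((\<lambda>x. f x * g x) has_derivative (\<lambda>v. f x * g' x v + f' x v * g x)) (at x)" for x
      by (intro has_derivative_mult f g)
    \<comment> \<open>Each of the two terms of the product rule contributes
      \<open>K * L\<close>.\<close>
    show "norm (f x * g' x v + f' x v * g x) \<le> (2 * K * L) * norm v" for x v
      using norm_add_rule_thm[OF prod[OF f(2)[of x] g(4)[of x v]]
          prod[OF f(4)[of x v] g(2)[of x]]] by (simp add: mult_ac)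
  qed
qed

lemma bounded_deriv_sum:
  "(\<And>i. i \<in> I \<Longrightarrow> bounded_deriv (f i)) \<Longrightarrow> bounded_deriv (\<lambda>x. \<Sum>i\<in>I. f i x)"
  by (induction I rule: infinite_finite_induct)
    (auto intro: bounded_deriv_const bounded_deriv_add)

lemma bounded_deriv_linear:
  assumes "bounded_linear h" "bounded_deriv f"
  shows "bounded_deriv (\<lambda>x. h (f x))"
proof -
  obtain f' K where f: "0 \<le> K" "\<And>x. norm (f x) \<le> K" "\<And>x. (f has_derivative f' x) (at x)"
    "\<And>x v. norm (f' x v) \<le> K * norm v"
    using assms(2) by (rule bounded_derivE) blast
  have h: "norm (h a) \<le> onorm h * b" if "norm a \<le> b" for a b
    using onorm[OF assms(1), of a] mult_left_mono[OF that onorm_pos_le[OF assms(1)]] by linarith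
  show ?thesis
  proof (rule bounded_derivI)
    show "norm (h (f x)) \<le> onorm h * K" for x
      by (intro h f)
    show "((\<lambda>x. h (f x)) has_derivative (\<lambda>v. h (f' x v))) (at x)" for x
      by (rule bounded_linear.has_derivative[OF assms(1) f(3)])
    show "norm (h (f' x v)) \<le> (onorm h * K) * norm v" for x v
      using h[OF f(4)] by (simp add: mult_ac)
  qed
qed

text \<open>Since the angle and the eigenvalue \<open>l\<close> are real, the phase has modulus 1,
  and differentiating it only brings down a factor of modulus at most \<open>\<bar>l\<bar>\<close>
  times the norm of the direction.\<close>

lemma bounded_deriv_phase:
  "bounded_deriv (\<lambda>\<theta> :: real ^ 'n. exp (- \<i> * complex_of_real (\<theta> $ k) * complex_of_real l))"
proof (rule bounded_derivI)
  fix \<theta> v :: "real ^ 'n"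
  let ?e = "exp (- \<i> * complex_of_real (\<theta> $ k) * complex_of_real l)"
  have e: "norm ?e = 1"
    using norm_exp_i_times[of "- (\<theta> $ k * l)"] by (simp add: mult_ac)
  then show "norm ?e \<le> 1" by simp
  have "((\<lambda>\<theta>. - \<i> * complex_of_real (\<theta> $ k) * complex_of_real l) has_derivative
      (\<lambda>v. - \<i> * complex_of_real (v $ k) * complex_of_real l)) (at \<theta>)"
    by (intro has_derivative_mult_left has_derivative_mult_right has_derivative_of_real
        bounded_linear_imp_has_derivative bounded_linear_vec_nth)
  then show "((\<lambda>\<theta>. exp (- \<i> * complex_of_real (\<theta> $ k) * complex_of_real l)) has_derivative
      (\<lambda>v. ?e * (- \<i> * complex_of_real (v $ k) * complex_of_real l))) (at \<theta>)"
    by (rule has_derivative_compose[OF _ has_field_derivative_imp_has_derivative[OF DERIV_exp]])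
  have "norm (?e * (- \<i> * complex_of_real (v $ k) * complex_of_real l)) = \<bar>l\<bar> * \<bar>v $ k\<bar>"
    unfolding norm_mult e by simp
  also have "\<dots> \<le> \<bar>l\<bar> * norm v"
    by (intro mult_left_mono component_le_norm_cart) auto
  finally show "norm (?e * (- \<i> * complex_of_real (v $ k) * complex_of_real l)) \<le> \<bar>l\<bar> * norm v" .
qed

section \<open>Continuity, gradients and Lipschitz bounds for this class\<close>

lemma bounded_deriv_continuous:
  assumes "bounded_deriv f"
  shows "continuous_on UNIV f"
  using assms
  by (meson bounded_derivE continuous_at_imp_continuous_on has_derivative_continuous)

text \<open>\<open>gradient\<close> is a definite description, so the Riesz representative of the
  derivative must be shown to exist and to be unique. The second claim makes the \<open>SUP\<close>
  in \<open>lipschitz_const\<close> a genuine supremum.\<close>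

lemma bounded_deriv_gradient:
  fixes f :: "'a::euclidean_space \<Rightarrow> real"
  assumes "bounded_deriv f"
  shows "GDERIV f x :> gradient f x"
    and "bdd_above (range (\<lambda>x. norm (gradient f x)))"
proof -
  obtain f' K where f: "0 \<le> K" "\<And>x. (f has_derivative f' x) (at x)"
    "\<And>x v. norm (f' x v) \<le> K * norm v"
    using assms by (rule bounded_derivE) blast
  have repr: "f' x = (\<lambda>v. v \<bullet> (\<Sum>b\<in>Basis. f' x b *\<^sub>R b))" for x
  proof
    fix v
    interpret linear "f' x"
      by (rule has_derivative_linear[OF f(2)])
    have "f' x v = f' x (\<Sum>b\<in>Basis. (v \<bullet> b) *\<^sub>R b)"
      by (simp add: euclidean_representation)
    then show "f' x v = v \<bullet> (\<Sum>b\<in>Basis. f' x b *\<^sub>R b)"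
      by (simp add: sum scale inner_sum_right mult_ac)
  qed
  have gderiv: "GDERIV f x :> gradient f x" for x
    unfolding gradient_def
  proof (rule theI)
    show "GDERIV f x :> (\<Sum>b\<in>Basis. f' x b *\<^sub>R b)"
      unfolding gderiv_def using f(2)[of x] by (subst (asm) repr)
    fix D assume "GDERIV f x :> D"
    then have "(\<lambda>v. v \<bullet> D) = f' x"
      unfolding gderiv_def using f(2) has_derivative_unique by blast
    then show "D = (\<Sum>b\<in>Basis. f' x b *\<^sub>R b)"
      using repr by (metis vector_eq_ldot)
  qed
  then show "GDERIV f x :> gradient f x" .
  have "norm (gradient f x) \<le> K" for x
  proof -
    let ?D = "gradient f x"
    have "(\<lambda>v. v \<bullet> ?D) = f' x"
      using gderiv[of x] unfolding gderiv_def using f(2) has_derivative_unique by blast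
    \<comment> \<open>Evaluating the derivative in the direction of the gradient itself bounds the
      gradient by the same \<open>K\<close>.\<close>
    then have "?D \<bullet> ?D = f' x ?D"
      by metis
    then have "norm ?D * norm ?D \<le> K * norm ?D"
      using f(3)[of x ?D] by (simp add: power2_norm_eq_inner[symmetric] power2_eq_square)
    then show ?thesis
      using f(1) by (cases "norm ?D = 0") auto
  qed
  then show "bdd_above (range (\<lambda>x. norm (gradient f x)))"
    by (intro bdd_aboveI2)
qed

text \<open>Mean value inequality on the whole space: by Cauchy--Schwarz the operator norm of the
  derivative is at most the norm of the gradient.\<close>

lemma bounded_deriv_lipschitz:
  fixes f :: "'a::euclidean_space \<Rightarrow> real"
  assumes "bounded_deriv f"
  shows "\<bar>f x - f y\<bar> \<le> (SUP z. norm (gradient f z)) * norm (x - y)"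
proof -
  have "norm (f x - f y) \<le> (SUP z. norm (gradient f z)) * norm (x - y)"
  proof (rule differentiable_bound[of UNIV])
    show "(f has_derivative (\<lambda>v. v \<bullet> gradient f z)) (at z within UNIV)" for z
      using bounded_deriv_gradient(1)[OF assms] by (simp add: gderiv_def)
    fix z
    have "onorm (\<lambda>v. v \<bullet> gradient f z) \<le> norm (gradient f z)"
      by (rule onorm_le) (metis Cauchy_Schwarz_ineq2 mult.commute real_norm_def)
    also have "\<dots> \<le> (SUP z. norm (gradient f z))"
      by (intro cSUP_upper bounded_deriv_gradient(2)[OF assms]) simp
    finally show "onorm (\<lambda>v. v \<bullet> gradient f z) \<le> (SUP z. norm (gradient f z))" .
  qed auto
  then show ?thesis by simp
qed


section \<open>The objective\<close>

text \<open>By the spectral formulas, a layer turns amplitudes into sums of products of phases,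
  constants and earlier amplitudes. The input state may depend on \<theta> so that layers can be
  composed.\<close>

lemma bounded_deriv_qaoa_layer:
  fixes \<psi> :: "'p::finite params \<Rightarrow> 'v::finite state"
  assumes "simple_graph E" "\<And>y. bounded_deriv (\<lambda>\<theta>. \<psi> \<theta> $ y)"
  shows "bounded_deriv (\<lambda>\<theta>. qaoa_layer E \<theta> k (\<psi> \<theta>) $ x)"
proof -
  have nat_phase: "bounded_deriv (\<lambda>\<theta> :: 'p params. exp (- \<i> * complex_of_real (\<theta> $ j) * of_nat c))"
    for j c
    using bounded_deriv_phase[of j "real c"] by simp
  show ?thesis
    unfolding qaoa_layer_def matrix_vector_mult_def matrix_exp_mixer_op
      matrix_exp_cost_op[OF assms(1)] vec_lambda_beta
    by (intro bounded_deriv_sum bounded_deriv_mult bounded_deriv_const bounded_deriv_phase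
        nat_phase assms(2))
qed

lemma bounded_deriv_fold_qaoa_layer:
  assumes "simple_graph E" "\<And>y. bounded_deriv (\<lambda>\<theta>. \<psi> \<theta> $ y)"
  shows "bounded_deriv (\<lambda>\<theta>. fold (qaoa_layer E \<theta>) ks (\<psi> \<theta>) $ x)"
  using assms(2)
\<comment> \<open>\<psi> is generalised because \<open>fold\<close> hands the output of the first
  layer to the remaining ones as their initial state.\<close>
proof (induction ks arbitrary: \<psi>)
  case (Cons k ks)
  show ?case
    using Cons.IH[of "\<lambda>\<theta>. qaoa_layer E \<theta> k (\<psi> \<theta>)"]
      bounded_deriv_qaoa_layer[OF assms(1) Cons.prems]
    by simp
qed simp

lemma bounded_deriv_qaoa_objective:
  assumes "simple_graph E"
  shows "bounded_deriv (qaoa_objective E :: 'p::{finite,linorder} params \<Rightarrow> real)"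
proof -
  have state: "bounded_deriv (\<lambda>\<theta> :: 'p params. qaoa_state E \<theta> $ x)" for x
    unfolding qaoa_state_def
    by (intro bounded_deriv_fold_qaoa_layer assms bounded_deriv_const)
  show ?thesis
    unfolding qaoa_objective_def braket_def matrix_vector_mult_def vec_lambda_beta
    by (intro bounded_deriv_linear[OF bounded_linear_Re] bounded_deriv_linear[OF bounded_linear_cnj]
        bounded_deriv_sum bounded_deriv_mult bounded_deriv_const state)
qed

text \<open>Continuity gives measurability, and boundedness gives integrability on a probability
  space. Thus the expectations below are not the default value 0 of a non-integrable
  function.\<close>

lemma integrable_qaoa_objective:
  fixes X :: "'a \<Rightarrow> 'p::{finite,linorder} params"
  assumes "simple_graph E" "prob_space M" "X \<in> borel_measurable M"
  shows "integrable M (\<lambda>\<omega>. qaoa_objective E (X \<omega>))"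
proof -
  interpret prob_space M by fact
  note bd = bounded_deriv_qaoa_objective[OF assms(1)]
  obtain K where K: "\<And>\<theta> :: 'p params. norm (qaoa_objective E \<theta>) \<le> K"
    using bd by (rule bounded_derivE) blast
  have "(\<lambda>\<omega>. qaoa_objective E (X \<omega>)) \<in> borel_measurable M"
    using assms(3) borel_measurable_continuous_onI[OF bounded_deriv_continuous[OF bd]]
    by (rule measurable_compose)
  then show ?thesis
    using K by (intro integrable_const_bound[where B = K] AE_I2)
qed

lemma qaoa_objective_lipschitz:
  fixes \<theta> \<mu> :: "'p::{finite,linorder} params"
  assumes "simple_graph E"
  shows "\<bar>qaoa_objective E \<theta> - qaoa_objective E \<mu>\<bar> \<le> lipschitz_const TYPE('p) E * norm (\<theta> - \<mu>)"
  unfolding lipschitz_const_def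
  by (rule bounded_deriv_lipschitz[OF bounded_deriv_qaoa_objective[OF assms]])

lemma lipschitz_const_nonneg:
  assumes "simple_graph E"
  shows "0 \<le> lipschitz_const TYPE('p::{finite,linorder}) E"
proof -
  have "0 \<le> norm (gradient (qaoa_objective E) (0 :: 'p params))"
    by simp
  also have "\<dots> \<le> lipschitz_const TYPE('p) E"
    unfolding lipschitz_const_def
    by (intro cSUP_upper bounded_deriv_gradient(2) bounded_deriv_qaoa_objective assms) simp
  finally show ?thesis .
qed


section \<open>Depolarizing noise\<close>

lemma trace_mult_ketbra: "trace (A ** ketbra u u) = braket u (A *v u)"
  by (simp add: trace_def matrix_matrix_mult_def braket_def matrix_vector_mult_def ketbra_def
      sum_distrib_left mult_ac)

lemma trace_scaleR: "trace (c *\<^sub>R A) = c *\<^sub>R trace (A :: 'a::real_algebra_1 ^ 'n ^ 'n)"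
  by (simp add: trace_def scaleR_right.sum)

text \<open>By linearity of the trace, the pure component contributes the noiseless objective and
  the maximally mixed one the mean cost.\<close>

lemma noisy_objective_affine:
  fixes \<theta> :: "'p::{finite,linorder} params"
  shows "noisy_objective E \<epsilon> \<theta> = (1 - noise_strength CARD('p) \<epsilon>) * qaoa_objective E \<theta> +
    noise_strength CARD('p) \<epsilon> * mean_cost (E :: 'v::finite set set)"
proof -
  let ?\<psi> = "qaoa_state E \<theta>"
  have scaleR_mult: "A ** (c *\<^sub>R B) = c *\<^sub>R (A ** B)" for A B :: "'v operator" and c
    by (simp add: vec_eq_iff matrix_matrix_mult_def scaleR_right.sum)
  have "cost_op E ** noisy_state E \<epsilon> \<theta> =
      (1 - noise_strength CARD('p) \<epsilon>) *\<^sub>R (cost_op E ** ketbra ?\<psi> ?\<psi>) +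
      noise_strength CARD('p) \<epsilon> *\<^sub>R ((1 / 2 ^ CARD('v)) *\<^sub>R cost_op E)"
    by (simp add: noisy_state_def Let_def matrix_add_ldistrib scaleR_mult)
  then have "trace (cost_op E ** noisy_state E \<epsilon> \<theta>) =
      (1 - noise_strength CARD('p) \<epsilon>) *\<^sub>R braket ?\<psi> (cost_op E *v ?\<psi>) +
      noise_strength CARD('p) \<epsilon> *\<^sub>R ((1 / 2 ^ CARD('v)) *\<^sub>R trace (cost_op E))"
    by (simp add: trace_add trace_scaleR trace_mult_ketbra)
  moreover have "trace (cost_op E) / 2 ^ CARD('v) = (1 / 2 ^ CARD('v)) *\<^sub>R trace (cost_op E)"
    by (simp add: scaleR_conv_of_real)
  ultimately show ?thesis
    by (simp add: noisy_objective_def qaoa_objective_def mean_cost_def)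
qed

text \<open>Flipping the bit at one endpoint of the edge negates the diagonal entries.\<close>
lemma trace_edge_ZZ:
  assumes "i \<noteq> j"
  shows "trace (edge_ZZ {i, j}) = 0"
proof -
  let ?f = "\<lambda>x :: 'a \<Rightarrow> bool. if x i = x j then 1 else (-1 :: complex)"
  have "sum ?f UNIV = (\<Sum>x\<in>UNIV. - ?f x)"
    by (rule sum.reindex_bij_witness[where i = "\<lambda>x. x(i := \<not> x i)" and j = "\<lambda>x. x(i := \<not> x i)"])
      (use assms in \<open>auto simp: fun_eq_iff\<close>)
  then have "sum ?f UNIV = 0"
    unfolding sum_negf by (simp only: complex_eq_iff) simp
  then show ?thesis
    by (simp add: trace_def edge_ZZ_pair[OF assms] pauli_Z_mult)
qed

text \<open>The ZZ terms are traceless, so every edge contributes half the trace of the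
  identity.\<close>

lemma mean_cost_eq:
  fixes E :: "'v::finite set set"
  assumes "simple_graph E"
  shows "mean_cost E = real (card E) / 2"
proof -
  have tr1: "trace (mat 1 :: 'v operator) = 2 ^ CARD('v)"
    by (simp only: trace_I card_fun card_UNIV_bool) simp
  have edge: "trace ((1 / 2) *\<^sub>R (mat 1 - edge_ZZ e)) = 2 ^ CARD('v) / (2 :: complex)" if "e \<in> E" for e
  proof -
    have "card e = 2"
      using assms that by (simp add: simple_graph_def)
    then obtain i j where "i \<noteq> j" "e = {i, j}"
      by (meson card_2_iff)
    then show ?thesis
      using tr1 trace_edge_ZZ[of i j] unfolding trace_scaleR trace_sub
      by (simp add: scaleR_conv_of_real)
  qed
  have "trace (cost_op E) = (\<Sum>e\<in>E. trace ((1 / 2) *\<^sub>R (mat 1 - edge_ZZ e)))"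
    unfolding cost_op_def trace_def sum_component by (rule sum.swap)
  also have "\<dots> = of_nat (card E) * (2 ^ CARD('v) / 2)"
    by (simp add: edge)
  finally have "trace (cost_op E) / 2 ^ CARD('v) = complex_of_real (real (card E) / 2)"
    by simp
  then show ?thesis
    by (simp only: mean_cost_def Re_complex_of_real)
qed


section \<open>Trust regions\<close>

lemma sym_pos_def_Cauchy_Schwarz:
  fixes S :: "real ^ 'n ^ 'n"
  assumes "sym_pos_def S"
  shows "(x \<bullet> (S *v y))\<^sup>2 \<le> (x \<bullet> (S *v x)) * (y \<bullet> (S *v y))"
proof (cases "y = 0")
  case False
  define a b where "a = x \<bullet> (S *v y)" and "b = y \<bullet> (S *v y)"
  have pos: "0 < z \<bullet> (S *v z)" if "z \<noteq> 0" for z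
    using assms that by (simp add: sym_pos_def_def)
  have b: "0 < b"
    using pos False by (simp add: b_def)
  have sym: "y \<bullet> (S *v x) = a"
    using assms by (metis a_def dot_lmul_matrix inner_commute sym_pos_def_def transpose_matrix_vector)
  \<comment> \<open>This vector is \<open>b\<close> times the part of \<open>x\<close> orthogonal to
    \<open>y\<close> for the form of \<open>S\<close>. Scaling by \<open>b\<close> avoids a
    division.\<close>
  have "0 \<le> (b *\<^sub>R x - a *\<^sub>R y) \<bullet> (S *v (b *\<^sub>R x - a *\<^sub>R y))"
    using pos[of "b *\<^sub>R x - a *\<^sub>R y"] by (cases "b *\<^sub>R x - a *\<^sub>R y = 0") auto
  also have "\<dots> = b * (b * (x \<bullet> (S *v x)) - a\<^sup>2)"
    by (simp add: matrix_vector_mult_diff_distrib matrix_vector_mult_scaleR inner_diff_left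
        inner_diff_right sym flip: a_def b_def)
      (simp add: algebra_simps power2_eq_square)
  finally have "0 \<le> b * (x \<bullet> (S *v x)) - a\<^sup>2"
    using b by (simp add: zero_le_mult_iff)
  then show ?thesis
    by (simp add: a_def b_def mult.commute)
qed simp

lemma sym_pos_def_norm_le:
  fixes S :: "real ^ 'n ^ 'n"
  assumes "sym_pos_def S"
  shows "(norm d)\<^sup>2 \<le> (d \<bullet> (matrix_inv S *v d)) * onorm ((*v) S)"
proof (cases "d = 0")
  case False
  define w where "w = matrix_inv S *v d"
  \<comment> \<open>A positive definite matrix has trivial kernel, hence is invertible. This makes
    \<open>matrix_inv S\<close>, defined by choice, an actual inverse.\<close>
  have "x = 0" if "S *v x = 0" for x
    using assms that unfolding sym_pos_def_def by (metis inner_zero_right less_irrefl)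
  then have "invertible S"
    by (simp add: invertible_left_inverse matrix_left_invertible_ker)
  then have "S ** matrix_inv S = mat 1"
    unfolding invertible_def matrix_inv_def by (rule someI2_ex) simp
  then have d: "S *v w = d"
    by (simp add: w_def matrix_vector_mul_assoc)
  have "0 \<le> w \<bullet> (S *v w)"
    using assms by (cases "w = 0") (auto simp: sym_pos_def_def less_imp_le)
  then have w: "0 \<le> w \<bullet> d"
    by (simp add: d)
  have lin: "bounded_linear ((*v) S)"
    by (rule matrix_vector_mul_bounded_linear)
  have "d \<bullet> (S *v d) \<le> norm d * norm (S *v d)"
    by (rule norm_cauchy_schwarz)
  also have "\<dots> \<le> norm d * (onorm ((*v) S) * norm d)"
    by (intro mult_left_mono onorm[OF lin]) simp
  finally have quad: "d \<bullet> (S *v d) \<le> onorm ((*v) S) * (norm d)\<^sup>2"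
    by (simp add: power2_eq_square mult_ac)
  have "((norm d)\<^sup>2)\<^sup>2 = (d \<bullet> (S *v w))\<^sup>2"
    by (simp add: d power2_norm_eq_inner)
  also have "\<dots> \<le> (d \<bullet> (S *v d)) * (w \<bullet> d)"
    using sym_pos_def_Cauchy_Schwarz[OF assms, of d w] by (simp add: d)
  also have "\<dots> \<le> (onorm ((*v) S) * (norm d)\<^sup>2) * (w \<bullet> d)"
    by (intro mult_right_mono quad w)
  finally have "(norm d)\<^sup>2 * (norm d)\<^sup>2 \<le> ((w \<bullet> d) * onorm ((*v) S)) * (norm d)\<^sup>2"
    by (simp add: power2_eq_square mult_ac)
  then have "(norm d)\<^sup>2 \<le> (w \<bullet> d) * onorm ((*v) S)"
    using False by (subst (asm) mult_le_cancel_right_pos) auto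
  then show ?thesis
    by (simp add: w_def inner_commute)
qed simp

lemma trust_region_norm_le:
  fixes \<mu> :: "'p::finite params"
  assumes "sym_pos_def S" "\<theta> \<in> trust_region \<mu> S \<alpha>"
  shows "norm (\<theta> - \<mu>) \<le> sqrt (quantile (chi_square (2 * CARD('p))) \<alpha> * onorm ((*v) S))"
proof (rule real_le_rsqrt)
  have "(norm (\<theta> - \<mu>))\<^sup>2 \<le> ((\<theta> - \<mu>) \<bullet> (matrix_inv S *v (\<theta> - \<mu>))) * onorm ((*v) S)"
    by (rule sym_pos_def_norm_le[OF assms(1)])
  also have "\<dots> \<le> quantile (chi_square (2 * CARD('p))) \<alpha> * onorm ((*v) S)"
    using assms(2) unfolding trust_region_def
    by (intro mult_right_mono onorm_pos_le matrix_vector_mul_bounded_linear) simp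
  finally show "(norm (\<theta> - \<mu>))\<^sup>2 \<le> quantile (chi_square (2 * CARD('p))) \<alpha> * onorm ((*v) S)" .
qed

section \<open>Expectations over the trust region and under noise\<close>

lemma expectation_trust_region:
  fixes \<mu> :: "'p::{finite,linorder} params"
  assumes "simple_graph E" "sym_pos_def S" "prob_space M" "X \<in> borel_measurable M"
    and "AE \<omega> in M. X \<omega> \<in> trust_region \<mu> S \<alpha>"
  shows "qaoa_objective E \<mu> - lipschitz_const TYPE('p) E *
      sqrt (quantile (chi_square (2 * CARD('p))) \<alpha> * onorm ((*v) S))
    \<le> prob_space.expectation M (\<lambda>\<omega>. qaoa_objective E (X \<omega>))"
    (is "?lower \<le> _")
proof -
  interpret prob_space M by fact
  \<comment> \<open>The bound holds pointwise almost surely; integrating it preserves the constant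
    because the total mass is 1.\<close>
  have "AE \<omega> in M. ?lower \<le> qaoa_objective E (X \<omega>)"
    using assms(5)
  proof eventually_elim
    case (elim \<omega>)
    have "lipschitz_const TYPE('p) E * norm (X \<omega> - \<mu>) \<le> lipschitz_const TYPE('p) E *
        sqrt (quantile (chi_square (2 * CARD('p))) \<alpha> * onorm ((*v) S))"
      by (intro mult_left_mono trust_region_norm_le[OF assms(2) elim]
          lipschitz_const_nonneg[OF assms(1)])
    with qaoa_objective_lipschitz[OF assms(1), of "X \<omega>" \<mu>] show ?case
      by linarith
  qed
  then have "expectation (\<lambda>\<omega>. ?lower) \<le> expectation (\<lambda>\<omega>. qaoa_objective E (X \<omega>))"
    by (intro integral_mono_AE integrable_qaoa_objective assms(1,3,4)) auto
  then show ?thesis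
    by (simp add: prob_space)
qed

lemma expectation_noisy_objective:
  fixes X :: "'a \<Rightarrow> 'p::{finite,linorder} params"
  assumes "simple_graph E" "prob_space M" "X \<in> borel_measurable M"
  shows "prob_space.expectation M (\<lambda>\<omega>. noisy_objective E \<epsilon> (X \<omega>)) =
    (1 - noise_strength CARD('p) \<epsilon>) * prob_space.expectation M (\<lambda>\<omega>. qaoa_objective E (X \<omega>)) +
    noise_strength CARD('p) \<epsilon> * mean_cost E"
proof -
  interpret prob_space M by fact
  show ?thesis
    using integrable_qaoa_objective[OF assms]
    by (simp add: noisy_objective_affine prob_space)
qed

theorem theorem16:
  fixes E :: "'v::finite set set"
    and \<mu> :: "'p::{finite,linorder} params"
    and S :: "real ^ ('p + 'p) ^ ('p + 'p)"
    and \<alpha> \<epsilon> \<nu> r :: real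
    and M :: "'a measure" and TR :: "'a \<Rightarrow> 'p params"
    and N :: "'b measure" and RD :: "'b \<Rightarrow> 'p params"
  assumes "simple_graph E" and "connected_graph E"
    and "0 < \<alpha>" and "\<alpha> < 1"
    and "sym_pos_def S"
    and "0 \<le> \<epsilon>" and "\<epsilon> \<le> 1"
    and "\<nu> = noise_strength CARD('p) \<epsilon>"
    and "prob_space M" and "TR \<in> borel_measurable M"
    and "AE \<omega> in M. TR \<omega> \<in> trust_region \<mu> S \<alpha>"
    and "prob_space N" and "RD \<in> borel_measurable N"
    and "0 < r" and "r * real (max_cut E) \<le> qaoa_objective E \<mu>"
  shows
    "(\<forall>\<theta> :: 'p params.
        noisy_objective E \<epsilon> \<theta> = (1 - \<nu>) * qaoa_objective E \<theta> + \<nu> * mean_cost E)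
     \<and> mean_cost E = real (card E) / 2
     \<and>
     prob_space.expectation M (\<lambda>\<omega>. noisy_objective E \<epsilon> (TR \<omega>))
       \<ge> (1 - \<nu>) * (r * real (max_cut E)
            - lipschitz_const TYPE('p) E
              * sqrt (quantile (chi_square (2 * CARD('p))) \<alpha> * onorm ((*v) S)))
          + \<nu> * mean_cost E
     \<and>
     prob_space.expectation M (\<lambda>\<omega>. noisy_objective E \<epsilon> (TR \<omega>))
       - prob_space.expectation N (\<lambda>\<omega>. noisy_objective E \<epsilon> (RD \<omega>))
     = (1 - \<nu>) * (prob_space.expectation M (\<lambda>\<omega>. qaoa_objective E (TR \<omega>))
                 - prob_space.expectation N (\<lambda>\<omega>. qaoa_objective E (RD \<omega>)))
     \<and>
     (\<epsilon> < 1 \<longrightarrow>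
      prob_space.expectation M (\<lambda>\<omega>. qaoa_objective E (TR \<omega>))
        > prob_space.expectation N (\<lambda>\<omega>. qaoa_objective E (RD \<omega>)) \<longrightarrow>
      prob_space.expectation M (\<lambda>\<omega>. noisy_objective E \<epsilon> (TR \<omega>))
        > prob_space.expectation N (\<lambda>\<omega>. noisy_objective E \<epsilon> (RD \<omega>)))
     \<and>
     (prob_space.expectation N (\<lambda>\<omega>. noisy_objective E \<epsilon> (RD \<omega>)) - mean_cost E \<noteq> 0 \<longrightarrow>
      prob_space.expectation N (\<lambda>\<omega>. qaoa_objective E (RD \<omega>)) - mean_cost E \<noteq> 0 \<and>
      (prob_space.expectation M (\<lambda>\<omega>. noisy_objective E \<epsilon> (TR \<omega>)) - mean_cost E)
        / (prob_space.expectation N (\<lambda>\<omega>. noisy_objective E \<epsilon> (RD \<omega>)) - mean_cost E)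
      = (prob_space.expectation M (\<lambda>\<omega>. qaoa_objective E (TR \<omega>)) - mean_cost E)
        / (prob_space.expectation N (\<lambda>\<omega>. qaoa_objective E (RD \<omega>)) - mean_cost E))"
proof -
  note noisy = noisy_objective_affine[where 'p = 'p, of E \<epsilon>, folded assms(8)]
  note ETR = expectation_noisy_objective[OF assms(1,9,10), of \<epsilon>, folded assms(8)]
  note ERD = expectation_noisy_objective[OF assms(1,12,13), of \<epsilon>, folded assms(8)]
  \<comment> \<open>This form shows that the damping factor is nonnegative, as the lower bound
    needs, and positive for \<open>\<epsilon> < 1\<close>, as strict advantage needs.\<close>
  have \<nu>: "1 - \<nu> = (1 - \<epsilon>) ^ (2 * CARD('p))"
    using assms(8) by (simp add: noise_strength_def)
  then have nonneg: "0 \<le> 1 - \<nu>"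
    using assms(7) by simp
  have pos: "0 < 1 - \<nu>" if "\<epsilon> < 1"
    using \<nu> that by simp
  have "(1 - \<nu>) * (r * real (max_cut E) - lipschitz_const TYPE('p) E
      * sqrt (quantile (chi_square (2 * CARD('p))) \<alpha> * onorm ((*v) S)))
    \<le> (1 - \<nu>) * prob_space.expectation M (\<lambda>\<omega>. qaoa_objective E (TR \<omega>))"
    using expectation_trust_region[OF assms(1,5,9,10,11)] assms(15)
    by (intro mult_left_mono nonneg) linarith
  then have lower: "(1 - \<nu>) * (r * real (max_cut E) - lipschitz_const TYPE('p) E
      * sqrt (quantile (chi_square (2 * CARD('p))) \<alpha> * onorm ((*v) S))) + \<nu> * mean_cost E
    \<le> (1 - \<nu>) * prob_space.expectation M (\<lambda>\<omega>. qaoa_objective E (TR \<omega>)) + \<nu> * mean_cost E"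
    by simp
  \<comment> \<open>Relative to the mean cost, noise is a pure scaling by \<open>1 - \<nu>\<close>.
    A nonzero noisy denominator forces this factor to be nonzero, so it cancels in the
    ratio.\<close>
  have shift: "(1 - \<nu>) * a + \<nu> * c - c = (1 - \<nu>) * (a - c)" for a c
    by (simp add: algebra_simps)
  have diff: "(1 - \<nu>) * a + c - ((1 - \<nu>) * b + c) = (1 - \<nu>) * (a - b)" for a b c
    by (simp add: algebra_simps)
  show ?thesis
    unfolding ETR ERD shift diff
    by (intro conjI allI impI noisy mean_cost_eq[OF assms(1)] lower refl)
      (use pos in simp_all)
qed

end
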